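(* Let $d\in\mathbb{N}$, let $\Omega\subset\mathbb{R}^d$ be a bounded domain with $C^1$-boundary, $\mu$ Lebesgue measure, $\sigma$ the surface area measure on $\partial\Omega$, $G$ the Green's function of $\Omega$ (for $-\Delta$ with zero Dirichlet data). Let $\overline A=(A_1\ A_2)$, $\overline A(f,g)=A_1f+A_2g$, be the solution operator of the Dirichlet problem $-\Delta x=f$ in $\Omega$, $x=g$ on $\partial\Omega$, given by $$(A_1f)(t)=\int_\Omega G(t,s)f(s)\,d\mu(s),\qquad(A_2g)(t)=-\int_{\partial\Omega}\frac{\partial G}{\partial\bar n}(t,s)\,g(s)\,d\sigma(s),\qquad t\in\Omega,$$ for $f\in B_\mu(\Omega)$, $g\in B_\sigma(\partial\Omega)$. Let $\omega_1,\omega_2$ be moduli of continuity, $W_1=H^{\omega_1}_\mu(\Omega)$, $W_2=H^{\omega_2}_\sigma(\partial\Omega)$, let $Q_1\subset\Omega$, $Q_2\subset\partial\Omega$ be sets of $n_1,n_2\in\mathbb{N}$ points, $e_1\in\mathbb{R}^{n_1}_+$, $e_2\in\mathbb{R}^{n_2}_+$, $I_i=I_{Q_i}$, $U_i=U_{e_i}$, $L_i=L_{\omega_i,Q_i,e_i}$, $\tau_i=\tau_{\omega_i,Q_i,e_i}$, $i=1,2$, and $\overline W=W_1\times W_2$, $\overline I=\mathrm{diag}(I_1,I_2)$, $\overline U=U_1\times U_2$. Let $Y\subset\mathfrak{M}(\Omega\cup\partial\Omega,\mu)$ be a normed lattice containing $B_\mu(\Omega\cup\partial\Omega)$. Then $\Phi=\overline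 A\,\overline L$, with $\overline L=\mathrm{diag}(L_1,L_2)$, is an optimal method of recovery of the operator $\overline A$ on the class $\overline W$ based on information $\overline I$ with $\overline U$-error, and $$\mathcal{E}(\overline A;\overline W;\overline I;\overline U)=\mathcal{E}(\overline A;\overline W;\overline I;\overline U;\Phi)=\|\overline A\,\overline\tau\|_Y,\qquad\overline\tau=\tau_1\times\tau_2,\quad \overline A\,\overline\tau=A_1\tau_1+A_2\tau_2.$$
   Context: $\frac{\partial G}{\partial\bar n}(t,s)$ is the outer normal derivative of $G(t,\cdot)$ at $s\in\partial\Omega$; the kernels $G$ and $-\partial G/\partial\bar n$ are non-negative. $B_\mu(\cdot)$, $B_\sigma(\cdot)$ denote essentially bounded functions on the indicated set with respect to the indicated measure. $\Omega$ carries the Euclidean metric; $\partial\Omega$ carries a fixed metric compatible with its topology, so that $\sigma$ is a Borel measure for it. $\rho$ below denotes the metric of the set in question. $\mathbb{R}_+=[0,\infty)$. A modulus of continuity is a continuous non-decreasing $\omega:\mathbb{R}_+\to\mathbb{R}_+$ with $\omega(0)=0$ and $\omega(t'+t'')\le\omega(t')+\omega(t'')$. For $M'=\Omega$ (equivalently, by continuous extension, the compact set $\Omega\cup\partial\Omega$) or $M'=\partial\Omega$, $H^\omega(M')$ (written $H^\omega_\mu(\Omega)$, $H^\omega_\sigma(\partial\Omega)$) is the set of real functions $x$ on $M'$ with $|x(t')-x(t'')|\le\omega(\rho(t',t''))$ for all $t',t''\in M'$. For $Q=\{q_1,\dots,q_n\}\subset M'$ and $e=(e^1,\dots,e^n)\in\mathbb{R}^n_+$: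 $I_Qx=(x(q_1),\dots,x(q_n))$; $U_e=[-e^1,e^1]\times\dots\times[-e^n,e^n]$; $\tau_{\omega,Q,e}(t)=\min_{1\le j\le n}(e^j+\omega(\rho(t,q_j)))$, $t\in M'$; $\Pi'_j=\{t\in M':\tau_{\omega,Q,e}(t)=e^j+\omega(\rho(t,q_j))\}$, $\Pi_1=\Pi'_1$, $\Pi_j=\Pi'_j\setminus\bigcup_{s<j}\Pi_s$; $L_{\omega,Q,e}z(t)=z_j$ for $t\in\Pi_j$, $z\in\mathbb{R}^n$. $\mathfrak{M}(\Omega\cup\partial\Omega,\mu)$ is the space of measurable a.e. finite functions modulo a.e. equality (note $\mu(\partial\Omega)=0$), ordered by $x'\prec x''$ iff $x'\le x''$ a.e. A normed lattice $Y$ in it is a normed space which is a vector lattice for the inherited order with $|x|\prec|y|\Rightarrow\|x\|_Y\le\|y\|_Y$. $\overline I(f,g)=(I_1f,I_2g)$; $\overline A\,\overline L(z_1,z_2)=A_1L_1z_1+A_2L_2z_2$. A method of recovery is an arbitrary map $\Phi:\mathbb{R}^{n_1}\times\mathbb{R}^{n_2}\to Y$; $\mathcal{E}(\overline A;\overline W;\overline I;\overline U;\Phi)=\sup_{\overline x\in\overline W}\sup_{\overline z\in\overline I\,\overline x+\overline U}\|\overline A\,\overline x-\Phi\overline z\|_Y$; $\mathcal{E}(\overline A;\overline W;\overline I;\overline U)$ is its infimum over $\Phi$; a method is optimal if it attains this infimum. *)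

theory Defs
  imports "HOL-Analysis.Analysis"
begin

definition hausdorff_pre :: "nat \<Rightarrow> real \<Rightarrow> 'a::metric_space set \<Rightarrow> ennreal" where
  "hausdorff_pre k \<delta> A =
     (INF C\<in>{C :: nat \<Rightarrow> 'a set. A \<subseteq> (\<Union>i. C i) \<and> (\<forall>i. bounded (C i) \<and> diameter (C i) \<le> \<delta>)}.
        \<Sum>i. if C i = {} then 0 else ennreal (unit_ball_vol (real k) * (diameter (C i) / 2) ^ k))"

definition hausdorff_outer :: "nat \<Rightarrow> 'a::metric_space set \<Rightarrow> ennreal" where
  "hausdorff_outer k A = (SUP \<delta>\<in>{0<..}. hausdorff_pre k \<delta> A)"

text \<open>
  The surface measure is the (d - 1)-dimensional Hausdorff measure, normalised so that it agrees
  with the usual area of hypersurfaces (for d = 1 it is the counting measure).  The Hausdorff outer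
  measure is a metric outer measure, hence countably additive on the Borel sets, as
  \<^const>\<open>measure_of\<close> requires.
\<close>

definition surface_measure :: "'a::euclidean_space set \<Rightarrow> 'a measure" where
  "surface_measure S =
     restrict_space (measure_of UNIV (sets borel) (hausdorff_outer (DIM('a) - 1))) S"

text \<open>
  Near \<open>p\<close> the set \<open>\<Omega>\<close> is the part above the graph of \<open>\<gamma>\<close> over the hyperplane orthogonal to the
  unit vector \<open>u\<close>; only the values of \<open>\<gamma>\<close> on that hyperplane are used.
\<close>

definition C1_graph_chart ::
  "'a::euclidean_space set \<Rightarrow> 'a \<Rightarrow> real \<Rightarrow> 'a \<Rightarrow> ('a \<Rightarrow> real) \<Rightarrow> bool" where
  "C1_graph_chart \<Omega> p r u \<gamma> \<longleftrightarrow>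
     r > 0 \<and> norm u = 1 \<and>
     (\<exists>g. continuous_on UNIV g \<and> (\<forall>x. GDERIV \<gamma> x :> g x)) \<and>
     \<Omega> \<inter> ball p r = {x \<in> ball p r. x \<bullet> u > \<gamma> (x - (x \<bullet> u) *\<^sub>R u)}"

definition C1_boundary :: "'a::euclidean_space set \<Rightarrow> bool" where
  "C1_boundary \<Omega> \<longleftrightarrow> (\<forall>p\<in>frontier \<Omega>. \<exists>r u \<gamma>. C1_graph_chart \<Omega> p r u \<gamma>)"

text \<open>
  In a chart, \<open>\<Omega>\<close> is the set where \<open>F x = \<gamma> (x - (x \<bullet> u) u) - x \<bullet> u\<close> is negative, so that the
  outer unit normal is the normalised gradient of \<open>F\<close>.
\<close>

definition outer_unit_normal :: "'a::euclidean_space set \<Rightarrow> 'a \<Rightarrow> 'a \<Rightarrow> bool" where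
  "outer_unit_normal \<Omega> p \<nu> \<longleftrightarrow>
     p \<in> frontier \<Omega> \<and>
     (\<exists>r u \<gamma> D. C1_graph_chart \<Omega> p r u \<gamma> \<and>
        GDERIV (\<lambda>x. \<gamma> (x - (x \<bullet> u) *\<^sub>R u) - x \<bullet> u) p :> D \<and> \<nu> = D /\<^sub>R norm D)"

text \<open>The derivative is one-sided, since \<open>v\<close> is only meaningful on the closure of \<open>\<Omega>\<close>.\<close>

definition has_outer_normal_derivative ::
  "'a::euclidean_space set \<Rightarrow> ('a \<Rightarrow> real) \<Rightarrow> 'a \<Rightarrow> real \<Rightarrow> bool" where
  "has_outer_normal_derivative \<Omega> v s D \<longleftrightarrow>
     (\<exists>\<nu>. outer_unit_normal \<Omega> s \<nu> \<and>
        ((\<lambda>h. (v s - v (s - h *\<^sub>R \<nu>)) / h) \<longlongrightarrow> D) (at_right 0))"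

text \<open>Includes that \<open>v\<close> is twice continuously differentiable on the open set \<open>S\<close>.\<close>

definition has_laplacian_on ::
  "('a::euclidean_space \<Rightarrow> real) \<Rightarrow> ('a \<Rightarrow> real) \<Rightarrow> 'a set \<Rightarrow> bool" where
  "has_laplacian_on v l S \<longleftrightarrow>
     (\<exists>g H. (\<forall>x\<in>S. GDERIV v x :> g x \<and> (g has_derivative H x) (at x) \<and>
                     l x = (\<Sum>b\<in>Basis. H x b \<bullet> b)) \<and>
            (\<forall>w. continuous_on S (\<lambda>x. H x w)))"

definition fundamental_solution :: "'a::euclidean_space \<Rightarrow> real" where
  "fundamental_solution x =
     (if DIM('a) = 1 then - norm x / 2
      else if DIM('a) = 2 then - ln (norm x) / (2 * pi)
      else 1 / (real DIM('a) * (real DIM('a) - 2) * unit_ball_vol (real DIM('a))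
                * norm x ^ (DIM('a) - 2)))"

text \<open>
  The diagonal values \<open>G t t\<close> are left open; they do not influence any of the integrals.
\<close>

definition greens_function :: "'a::euclidean_space set \<Rightarrow> ('a \<Rightarrow> 'a \<Rightarrow> real) \<Rightarrow> bool" where
  "greens_function \<Omega> G \<longleftrightarrow>
     (\<forall>t\<in>\<Omega>. \<exists>h. continuous_on (closure \<Omega>) h \<and> has_laplacian_on h (\<lambda>_. 0) \<Omega> \<and>
        (\<forall>s\<in>frontier \<Omega>. h s = fundamental_solution (s - t)) \<and>
        (\<forall>s\<in>closure \<Omega> - {t}. G t s = fundamental_solution (s - t) - h s))"

definition ess_bounded :: "'a measure \<Rightarrow> ('a \<Rightarrow> real) set" where
  "ess_bounded M = {f \<in> borel_measurable M. \<exists>C. AE x in M. \<bar>f x\<bar> \<le> C}"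

text \<open>
  Bounded solutions for merely bounded data: the equation \<open>- \<Delta>x = f\<close> holds in the weak sense, and
  the boundary values \<open>g\<close> are non-tangential limits almost everywhere on the boundary.
\<close>

definition dirichlet_solution ::
  "'a::euclidean_space set \<Rightarrow> ('a \<Rightarrow> real) \<Rightarrow> ('a \<Rightarrow> real) \<Rightarrow> ('a \<Rightarrow> real) \<Rightarrow> bool" where
  "dirichlet_solution \<Omega> f g x \<longleftrightarrow>
     x \<in> ess_bounded (lebesgue_on \<Omega>) \<and>
     (\<forall>\<phi> l K. compact K \<and> K \<subseteq> \<Omega> \<and> (\<forall>t. t \<notin> K \<longrightarrow> \<phi> t = 0) \<and> has_laplacian_on \<phi> l UNIV \<longrightarrow>
        - (LINT t|lebesgue_on \<Omega>. x t * l t) = (LINT t|lebesgue_on \<Omega>. f t * \<phi> t)) \<and>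
     (AE s in surface_measure (frontier \<Omega>). \<forall>\<alpha>>0.
        (x \<longlongrightarrow> g s) (at s within {t\<in>\<Omega>. dist t s < (1 + \<alpha>) * infdist t (frontier \<Omega>)}))"

text \<open>
  \<open>dirichlet_operator \<Omega> A\<^sub>1 A\<^sub>2\<close> is the operator \<open>(f, g) \<mapsto> A\<^sub>1 f + A\<^sub>2 g\<close>; its values are functions
  on \<open>\<Omega>\<close>, extended by 0 to the null set \<open>frontier \<Omega>\<close> in order to be elements of
  the space of measurable functions on \<open>\<Omega> \<union> frontier \<Omega>\<close>.
\<close>

definition dirichlet_operator ::
  "'a set \<Rightarrow> (('a \<Rightarrow> real) \<Rightarrow> 'a \<Rightarrow> real) \<Rightarrow> (('a \<Rightarrow> real) \<Rightarrow> 'a \<Rightarrow> real) \<Rightarrow>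
   ('a \<Rightarrow> real) \<times> ('a \<Rightarrow> real) \<Rightarrow> 'a \<Rightarrow> real" where
  "dirichlet_operator \<Omega> A1 A2 x = (\<lambda>t. if t \<in> \<Omega> then A1 (fst x) t + A2 (snd x) t else 0)"

definition modulus_of_continuity :: "(real \<Rightarrow> real) \<Rightarrow> bool" where
  "modulus_of_continuity \<omega> \<longleftrightarrow>
     continuous_on {0..} \<omega> \<and> mono_on {0..} \<omega> \<and> \<omega> 0 = 0 \<and>
     (\<forall>t\<ge>0. \<forall>t'\<ge>0. \<omega> (t + t') \<le> \<omega> t + \<omega> t')"

definition H_class :: "(real \<Rightarrow> real) \<Rightarrow> ('a \<Rightarrow> 'a \<Rightarrow> real) \<Rightarrow> 'a set \<Rightarrow> ('a \<Rightarrow> real) set" where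
  "H_class \<omega> \<rho> M = {x. \<forall>t\<in>M. \<forall>t'\<in>M. \<bar>x t - x t'\<bar> \<le> \<omega> (\<rho> t t')}"

text \<open>
  A set of \<open>n\<close> points is an injective family over an index type \<open>'n\<close> with \<open>n = CARD('n)\<close>; the
  well-order on \<open>'n\<close> plays the role of the numbering \<open>1, \<dots>, n\<close>.
\<close>

definition sample :: "('n::finite \<Rightarrow> 'a) \<Rightarrow> ('a \<Rightarrow> real) \<Rightarrow> real ^ 'n" where
  "sample q x = (\<chi> j. x (q j))"

definition error_box :: "real ^ 'n::finite \<Rightarrow> (real ^ 'n) set" where
  "error_box e = {z. \<forall>j. z $ j \<in> {- (e $ j)..e $ j}}"

definition tau ::
  "(real \<Rightarrow> real) \<Rightarrow> ('a \<Rightarrow> 'a \<Rightarrow> real) \<Rightarrow> ('n::finite \<Rightarrow> 'a) \<Rightarrow> real ^ 'n \<Rightarrow> 'a \<Rightarrow> real" where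
  "tau \<omega> \<rho> q e t = Min (range (\<lambda>j. e $ j + \<omega> (\<rho> t (q j))))"

definition pre_cell ::
  "(real \<Rightarrow> real) \<Rightarrow> ('a \<Rightarrow> 'a \<Rightarrow> real) \<Rightarrow> 'a set \<Rightarrow> ('n::finite \<Rightarrow> 'a) \<Rightarrow> real ^ 'n \<Rightarrow> 'n \<Rightarrow> 'a set"
  where
  "pre_cell \<omega> \<rho> M q e j = {t\<in>M. tau \<omega> \<rho> q e t = e $ j + \<omega> (\<rho> t (q j))}"

lemmas [fundef_cong] = SUP_cong

function cell ::
  "(real \<Rightarrow> real) \<Rightarrow> ('a \<Rightarrow> 'a \<Rightarrow> real) \<Rightarrow> 'a set \<Rightarrow> ('n::{finite,wellorder} \<Rightarrow> 'a) \<Rightarrow> real ^ 'n::{finite,wellorder} \<Rightarrow>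
   'n \<Rightarrow> 'a set" where
  "cell \<omega> \<rho> M q e j = pre_cell \<omega> \<rho> M q e j - (\<Union>s\<in>{..<j}. cell \<omega> \<rho> M q e s)"
  by pat_completeness auto
termination
  by (relation "inv_image {(s, j). s < j} (\<lambda>(\<omega>, \<rho>, M, q, e, j). j)") (auto simp: wf)

declare cell.simps [simp del]

definition L_method ::
  "(real \<Rightarrow> real) \<Rightarrow> ('a \<Rightarrow> 'a \<Rightarrow> real) \<Rightarrow> 'a set \<Rightarrow> ('n::{finite,wellorder} \<Rightarrow> 'a) \<Rightarrow> real ^ 'n::{finite,wellorder} \<Rightarrow>
   real ^ 'n::{finite,wellorder} \<Rightarrow> 'a \<Rightarrow> real" where
  "L_method \<omega> \<rho> M q e z t = z $ (THE j. t \<in> cell \<omega> \<rho> M q e j)"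

text \<open>
  Elements of the space of measurable functions modulo almost everywhere equality are given by
  representatives, finite everywhere, so \<open>Y\<close> and \<open>N\<close> have to be invariant under changes on null
  sets.  Suprema and moduli are those of the inherited order, taken within \<open>Y\<close>.
\<close>

definition ae_le :: "'a measure \<Rightarrow> ('a \<Rightarrow> real) \<Rightarrow> ('a \<Rightarrow> real) \<Rightarrow> bool" where
  "ae_le M x y \<longleftrightarrow> (AE t in M. x t \<le> y t)"

definition is_join ::
  "'a measure \<Rightarrow> ('a \<Rightarrow> real) set \<Rightarrow> ('a \<Rightarrow> real) \<Rightarrow> ('a \<Rightarrow> real) \<Rightarrow> ('a \<Rightarrow> real) \<Rightarrow> bool" where
  "is_join M Y x y z \<longleftrightarrow>
     z \<in> Y \<and> ae_le M x z \<and> ae_le M y z \<and> (\<forall>w\<in>Y. ae_le M x w \<and> ae_le M y w \<longrightarrow> ae_le M z w)"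

locale normed_function_lattice =
  fixes M :: "'a measure" and Y :: "('a \<Rightarrow> real) set" and N :: "('a \<Rightarrow> real) \<Rightarrow> real"
  assumes measurable: "Y \<subseteq> borel_measurable M"
    and ae_closed: "\<lbrakk>x \<in> Y; y \<in> borel_measurable M; AE t in M. x t = y t\<rbrakk> \<Longrightarrow> y \<in> Y"
    and zero_closed: "(\<lambda>_. 0) \<in> Y"
    and add_closed: "\<lbrakk>x \<in> Y; y \<in> Y\<rbrakk> \<Longrightarrow> (\<lambda>t. x t + y t) \<in> Y"
    and scale_closed: "x \<in> Y \<Longrightarrow> (\<lambda>t. c * x t) \<in> Y"
    and norm_ae_cong: "\<lbrakk>x \<in> Y; y \<in> Y; AE t in M. x t = y t\<rbrakk> \<Longrightarrow> N x = N y"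
    and norm_nonneg: "x \<in> Y \<Longrightarrow> N x \<ge> 0"
    and norm_zero_iff: "x \<in> Y \<Longrightarrow> N x = 0 \<longleftrightarrow> (AE t in M. x t = 0)"
    and norm_scale: "x \<in> Y \<Longrightarrow> N (\<lambda>t. c * x t) = \<bar>c\<bar> * N x"
    and norm_triangle: "\<lbrakk>x \<in> Y; y \<in> Y\<rbrakk> \<Longrightarrow> N (\<lambda>t. x t + y t) \<le> N x + N y"
    and join_exists: "\<lbrakk>x \<in> Y; y \<in> Y\<rbrakk> \<Longrightarrow> \<exists>z. is_join M Y x y z"
    and norm_mono:
      "\<lbrakk>x \<in> Y; y \<in> Y; is_join M Y x (\<lambda>t. - x t) x'; is_join M Y y (\<lambda>t. - y t) y'; ae_le M x' y'\<rbrakk>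
       \<Longrightarrow> N x \<le> N y"

definition recovery_error ::
  "(('a \<Rightarrow> real) \<Rightarrow> real) \<Rightarrow> ('x \<Rightarrow> 'a \<Rightarrow> real) \<Rightarrow> 'x set \<Rightarrow> ('x \<Rightarrow> 'z::plus) \<Rightarrow> 'z set \<Rightarrow>
   ('z \<Rightarrow> 'a \<Rightarrow> real) \<Rightarrow> ennreal" where
  "recovery_error N A W I U \<Phi> =
     (SUP x\<in>W. SUP z\<in>(\<lambda>u. I x + u) ` U. ennreal (N (\<lambda>t. A x t - \<Phi> z t)))"

definition optimal_error ::
  "('a \<Rightarrow> real) set \<Rightarrow> (('a \<Rightarrow> real) \<Rightarrow> real) \<Rightarrow> ('x \<Rightarrow> 'a \<Rightarrow> real) \<Rightarrow> 'x set \<Rightarrow>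
   ('x \<Rightarrow> 'z::plus) \<Rightarrow> 'z set \<Rightarrow> ennreal" where
  "optimal_error Y N A W I U = (INF \<Phi>\<in>{\<Phi>. range \<Phi> \<subseteq> Y}. recovery_error N A W I U \<Phi>)"

definition optimal_method ::
  "('a \<Rightarrow> real) set \<Rightarrow> (('a \<Rightarrow> real) \<Rightarrow> real) \<Rightarrow> ('x \<Rightarrow> 'a \<Rightarrow> real) \<Rightarrow> 'x set \<Rightarrow>
   ('x \<Rightarrow> 'z::plus) \<Rightarrow> 'z set \<Rightarrow> ('z \<Rightarrow> 'a \<Rightarrow> real) \<Rightarrow> bool" where
  "optimal_method Y N A W I U \<Phi> \<longleftrightarrow>
     range \<Phi> \<subseteq> Y \<and> recovery_error N A W I U \<Phi> = optimal_error Y N A W I U"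

end

theory Submission
  imports Defs
begin

text \<open>
  On every cell the function \<open>\<tau>\<close> dominates the deviation between a function of the class and the
  piecewise constant reconstruction from its perturbed samples, so positivity of the kernels bounds
  the error of \<open>\<Phi>\<close> by the norm of \<open>A \<tau>\<close>.  Conversely \<open>\<tau>\<close> and \<open>- \<tau>\<close> both belong to the class
  and both admit the zero vector as perturbed information, so no method does better.
\<close>

section \<open>Integrals against non-negative kernels\<close>

text \<open>Multiplying the pointwise bound by a non-negative kernel preserves it, and integration
  is monotone. The sign is asked for only almost everywhere because \<open>G t\<close> is left open
  at \<open>t\<close> and \<open>dG t\<close> is controlled only up to null sets.\<close>

lemma kernel_integral_abs_diff_le:
  fixes k f g h :: "'a \<Rightarrow> real"
  assumes "AE s in M. k s \<ge> 0"
    and f: "has_bochner_integral M (\<lambda>s. k s * f s) a"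
    and g: "has_bochner_integral M (\<lambda>s. k s * g s) b"
    and h: "has_bochner_integral M (\<lambda>s. k s * h s) c"
    and le: "\<And>s. s \<in> space M \<Longrightarrow> \<bar>f s - g s\<bar> \<le> h s"
  shows "\<bar>a - b\<bar> \<le> c"
proof -
  have d: "has_bochner_integral M (\<lambda>s. k s * f s - k s * g s) (a - b)"
    using f g by (rule has_bochner_integral_diff)
  have "AE s in M. \<bar>k s * f s - k s * g s\<bar> \<le> k s * h s"
    using assms(1) AE_space
  proof eventually_elim
    case (elim s)
    then have "k s * \<bar>f s - g s\<bar> \<le> k s * h s"
      by (intro mult_left_mono le)
    then show ?case
      using elim by (simp add: abs_mult flip: right_diff_distrib)
  qed
  then have "(LINT s|M. \<bar>k s * f s - k s * g s\<bar>) \<le> (LINT s|M. k s * h s)"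
    using d h by (intro integral_mono_AE) (auto simp only: has_bochner_integral_iff integrable_abs)
  with d h integral_abs_bound[of M "\<lambda>s. k s * f s - k s * g s"] show ?thesis
    by (simp only: has_bochner_integral_iff)
qed

text \<open>Uniqueness of the integral. It makes \<open>A\<^sub>1\<close> and
  \<open>A\<^sub>2\<close>, which are known only through their integrals, odd on essentially bounded
  data.\<close>

lemma has_bochner_integral_mult_uminus:
  fixes k f :: "'a \<Rightarrow> real"
  assumes "has_bochner_integral M (\<lambda>s. k s * f s) a"
    and "has_bochner_integral M (\<lambda>s. k s * - f s) b"
  shows "b = - a"
  using assms(2) has_bochner_integral_minus[OF assms(1)]
  by (auto intro: has_bochner_integral_eq)

section \<open>Essentially bounded functions\<close>

lemma ess_bounded_uminus: "f \<in> ess_bounded M \<Longrightarrow> (\<lambda>x. - f x) \<in> ess_bounded M"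
  by (auto simp: ess_bounded_def)

lemma ess_bounded_diff:
  assumes "f \<in> ess_bounded M" "g \<in> ess_bounded M"
  shows "(\<lambda>x. f x - g x) \<in> ess_bounded M"
proof -
  obtain B C where "AE x in M. \<bar>f x\<bar> \<le> B" "AE x in M. \<bar>g x\<bar> \<le> C"
    using assms by (auto simp: ess_bounded_def)
  then have "AE x in M. \<bar>f x - g x\<bar> \<le> B + C"
    by eventually_elim linarith
  then show ?thesis
    using assms by (auto simp: ess_bounded_def)
qed

lemma ess_bounded_abs: "f \<in> ess_bounded M \<Longrightarrow> (\<lambda>x. \<bar>f x\<bar>) \<in> ess_bounded M"
  by (auto simp: ess_bounded_def)

lemma ess_bounded_lebesgue_on_extend:
  assumes "S \<in> sets lebesgue" "T \<in> sets lebesgue" "S \<subseteq> T" "f \<in> ess_bounded (lebesgue_on S)"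
  shows "(\<lambda>t. if t \<in> S then f t else 0) \<in> ess_bounded (lebesgue_on T)"
proof -
  obtain B where f: "f \<in> borel_measurable (lebesgue_on S)" and B: "AE x in lebesgue_on S. \<bar>f x\<bar> \<le> B"
    using assms(4) by (auto simp: ess_bounded_def)
  have "(\<lambda>t. if t \<in> S then f t else 0) \<in> borel_measurable lebesgue"
    using f assms(1) by (simp add: borel_measurable_if)
  then have "(\<lambda>t. if t \<in> S then f t else 0) \<in> borel_measurable (lebesgue_on T)"
    by (rule measurable_restrict_space1)
  moreover have "AE x in lebesgue. x \<in> S \<longrightarrow> \<bar>f x\<bar> \<le> B"
    using B assms(1) by (simp add: AE_restrict_space_iff)
  \<comment> \<open>\<open>B\<close> can be negative when \<open>S\<close> is a null set, whereas
    the extension by 0 needs a non-negative bound.\<close>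
  then have "AE x in lebesgue_on T. \<bar>if x \<in> S then f x else 0\<bar> \<le> max B 0"
    using assms(2) by (auto simp: AE_restrict_space_iff elim!: eventually_mono)
  ultimately show ?thesis
    unfolding ess_bounded_def by blast
qed

section \<open>Norm estimates in the lattice\<close>

text \<open>Turns \<open>norm_mono\<close>, which speaks of joins taken inside \<open>Y\<close>,
  into a statement on pointwise moduli: the modulus of an essentially bounded \<open>z\<close> lies
  in \<open>Y\<close> again, hence is the join of \<open>z\<close> and \<open>- z\<close>.\<close>

lemma (in normed_function_lattice) norm_mono_ess_bounded:
  assumes Y: "ess_bounded M \<subseteq> Y" and x: "x \<in> ess_bounded M" and y: "y \<in> ess_bounded M"
    and le: "AE t in M. \<bar>x t\<bar> \<le> \<bar>y t\<bar>"
  shows "N x \<le> N y"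
proof -
  have join: "is_join M Y z (\<lambda>t. - z t) (\<lambda>t. \<bar>z t\<bar>)" if "z \<in> ess_bounded M" for z
    using Y ess_bounded_abs[OF that]
    by (fastforce simp: is_join_def ae_le_def abs_le_iff)
  show ?thesis
    using norm_mono[OF _ _ join[OF x] join[OF y]] Y x y le by (auto simp: ae_le_def)
qed

text \<open>Since 2 x = (x - y) - (- x - y), the two norms on the right add up to at least 2 N x, so
  the larger one is at least N x. Later \<open>y\<close> is the single answer of a method to
  information shared by two opposite elements of the class.\<close>

lemma (in normed_function_lattice) norm_le_max_diff:
  assumes "x \<in> Y" "y \<in> Y"
  shows "N x \<le> max (N (\<lambda>t. x t - y t)) (N (\<lambda>t. - x t - y t))"
proof -
  have minus: "(\<lambda>t. - z t) \<in> Y" if "z \<in> Y" for z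
    using scale_closed[OF that, of "-1"] by simp
  have "(\<lambda>t. x t - y t) \<in> Y" "(\<lambda>t. - x t - y t) \<in> Y"
    using add_closed[of x "\<lambda>t. - y t"] add_closed[of "\<lambda>t. - x t" "\<lambda>t. - y t"] minus assms by auto
  then have "N (\<lambda>t. (x t - y t) + (-1) * (- x t - y t)) \<le> N (\<lambda>t. x t - y t) + N (\<lambda>t. - x t - y t)"
    using norm_triangle[of "\<lambda>t. x t - y t" "\<lambda>t. (-1) * (- x t - y t)"]
      scale_closed[of "\<lambda>t. - x t - y t" "-1"] norm_scale[of "\<lambda>t. - x t - y t" "-1"]
    by simp
  also have "(\<lambda>t. (x t - y t) + (-1) * (- x t - y t)) = (\<lambda>t. 2 * x t)"
    by auto
  finally show ?thesis
    using norm_scale[of x 2] assms by simp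
qed

section \<open>A class of functions with perturbed samples\<close>

text \<open>One setting for both kinds of data: the domain with Euclidean distance and Lebesgue
  measure, and its boundary with its own metric and surface measure. Continuity refers to the
  ambient topology, to which \<open>metric_continuous\<close> ties \<rho>;
  \<open>metric_bounded\<close> stands in for compactness, as the domain is open.\<close>

locale sampled_class = Metric_space M \<rho>
  for M :: "'a::topological_space set" and \<rho> +
  fixes \<nu> :: "'a measure" and \<omega> :: "real \<Rightarrow> real"
    and q :: "'n::{finite,wellorder} \<Rightarrow> 'a" and e :: "real ^ 'n::{finite,wellorder}"
  assumes space_eq: "space \<nu> = M"
    and continuous_measurable: "\<And>f :: 'a \<Rightarrow> real. continuous_on M f \<Longrightarrow> f \<in> borel_measurable \<nu>"
    and metric_continuous: "\<And>p. p \<in> M \<Longrightarrow> continuous_on M (\<lambda>t. \<rho> t p)"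
    and metric_bounded: "\<And>p. p \<in> M \<Longrightarrow> \<exists>B. \<forall>t\<in>M. \<rho> t p \<le> B"
    and modulus: "modulus_of_continuity \<omega>"
    and points: "q j \<in> M"
    and errors: "e $ j \<ge> 0"
begin

lemma modulus_zero: "\<omega> 0 = 0"
  using modulus unfolding modulus_of_continuity_def by blast

lemma modulus_mono: "0 \<le> s \<Longrightarrow> s \<le> t \<Longrightarrow> \<omega> s \<le> \<omega> t"
  using modulus unfolding modulus_of_continuity_def by (auto intro: mono_onD[of "{0..}" \<omega>])

lemma modulus_nonneg: "0 \<le> s \<Longrightarrow> 0 \<le> \<omega> s"
  using modulus_mono[of 0 s] modulus_zero by simp

lemma modulus_metric_continuous:
  assumes "p \<in> M"
  shows "continuous_on M (\<lambda>t. \<omega> (\<rho> t p))"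
proof -
  have "continuous_on {0..} \<omega>"
    using modulus unfolding modulus_of_continuity_def by blast
  then show ?thesis
    using metric_continuous[OF assms] by (rule continuous_on_compose2) auto
qed

lemma modulus_metric_triangle:
  assumes "s \<in> M" "t \<in> M" "p \<in> M"
  shows "\<omega> (\<rho> s p) \<le> \<omega> (\<rho> s t) + \<omega> (\<rho> t p)"
proof -
  have "\<omega> (\<rho> s p) \<le> \<omega> (\<rho> s t + \<rho> t p)"
    using assms by (intro modulus_mono triangle) auto
  also have "\<dots> \<le> \<omega> (\<rho> s t) + \<omega> (\<rho> t p)"
    using modulus by (simp add: modulus_of_continuity_def)
  finally show ?thesis .
qed

section \<open>The function \<tau> and its membership in the class\<close>

lemma tau_le: "tau \<omega> \<rho> q e t \<le> e $ j + \<omega> (\<rho> t (q j))"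
  unfolding tau_def by (intro Min_le) auto

lemma tau_attained: "\<exists>j. tau \<omega> \<rho> q e t = e $ j + \<omega> (\<rho> t (q j))"
proof -
  have "tau \<omega> \<rho> q e t \<in> range (\<lambda>j. e $ j + \<omega> (\<rho> t (q j)))"
    unfolding tau_def by (intro Min_in) auto
  then show ?thesis
    by auto
qed

lemma tau_nonneg: "0 \<le> tau \<omega> \<rho> q e t"
proof -
  obtain j where "tau \<omega> \<rho> q e t = e $ j + \<omega> (\<rho> t (q j))"
    using tau_attained by blast
  then show ?thesis
    using errors[of j] modulus_nonneg[OF nonneg, of t "q j"] by linarith
qed

text \<open>Each term of the minimum has modulus \<omega>, by subadditivity and the triangle
  inequality. The minimum inherits it, because an index attaining the minimum at \<open>t\<close> is
  a competitor at \<open>s\<close>.\<close>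

lemma tau_H_class: "tau \<omega> \<rho> q e \<in> H_class \<omega> \<rho> M"
proof -
  have "tau \<omega> \<rho> q e s \<le> tau \<omega> \<rho> q e t + \<omega> (\<rho> s t)" if "s \<in> M" "t \<in> M" for s t
  proof -
    obtain j where "tau \<omega> \<rho> q e t = e $ j + \<omega> (\<rho> t (q j))"
      using tau_attained by blast
    then show ?thesis
      using tau_le[of s j] modulus_metric_triangle[OF that points, of j] by linarith
  qed
  note * = this
  show ?thesis
    unfolding H_class_def
  proof (intro CollectI ballI)
    fix s t assume "s \<in> M" "t \<in> M"
    then show "\<bar>tau \<omega> \<rho> q e s - tau \<omega> \<rho> q e t\<bar> \<le> \<omega> (\<rho> s t)"
      using *[of s t] *[of t s] commute[of s t] by (simp add: abs_le_iff)
  qed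
qed

text \<open>As \<omega> vanishes at 0, the j-th term of the minimum is just \<open>e $ j\<close> at
  \<open>q j\<close>. This makes the zero vector admissible information for \<tau>.\<close>

lemma sample_tau: "sample q (tau \<omega> \<rho> q e) \<in> error_box e"
proof -
  have "tau \<omega> \<rho> q e (q j) \<le> e $ j" for j
    using tau_le[of "q j" j] points[of j] modulus_zero by simp
  moreover have "- e $ j \<le> tau \<omega> \<rho> q e (q j)" for j
    using tau_nonneg[of "q j"] errors[of j] by linarith
  ultimately show ?thesis
    by (simp add: error_box_def sample_def)
qed

text \<open>The increments at \<open>p\<close> are squeezed by \<omega> of the distance to
  \<open>p\<close>, which is continuous and vanishes there.\<close>

lemma H_class_continuous:
  assumes "x \<in> H_class \<omega> \<rho> M"
  shows "continuous_on M x"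
  unfolding continuous_on_def
proof
  fix p assume p: "p \<in> M"
  have "((\<lambda>t. \<omega> (\<rho> t p)) \<longlongrightarrow> \<omega> (\<rho> p p)) (at p within M)"
    using modulus_metric_continuous[OF p] p by (auto simp: continuous_on_def)
  then have "((\<lambda>t. \<omega> (\<rho> t p)) \<longlongrightarrow> 0) (at p within M)"
    using p modulus_zero by simp
  moreover have "\<forall>\<^sub>F t in at p within M. norm (x t - x p) \<le> \<omega> (\<rho> t p)"
    using assms p by (auto simp: H_class_def eventually_at_filter)
  ultimately have "((\<lambda>t. x t - x p) \<longlongrightarrow> 0) (at p within M)"
    by (rule Lim_null_comparison[rotated])
  then show "(x \<longlongrightarrow> x p) (at p within M)"
    by (rule LIM_zero_cancel)
qed

lemma H_class_ess_bounded:
  assumes "x \<in> H_class \<omega> \<rho> M"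
  shows "x \<in> ess_bounded \<nu>"
proof -
  \<comment> \<open>An arbitrary sample point serves as anchor for the bound; it exists because the
    index type is nonempty.\<close>
  define p where "p = q undefined"
  have p: "p \<in> M"
    using points by (simp add: p_def)
  obtain B where B: "\<And>t. t \<in> M \<Longrightarrow> \<rho> t p \<le> B"
    using metric_bounded[OF p] by blast
  have "\<bar>x t\<bar> \<le> \<bar>x p\<bar> + \<omega> B" if "t \<in> M" for t
  proof -
    have "\<bar>x t - x p\<bar> \<le> \<omega> (\<rho> t p)"
      using assms that p by (auto simp: H_class_def)
    also have "\<dots> \<le> \<omega> B"
      using that by (intro modulus_mono B) auto
    finally show ?thesis
      by linarith
  qed
  then have "AE t in \<nu>. \<bar>x t\<bar> \<le> \<bar>x p\<bar> + \<omega> B"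
    by (intro AE_I2) (simp add: space_eq)
  then show ?thesis
    using continuous_measurable[OF H_class_continuous[OF assms]] by (auto simp: ess_bounded_def)
qed

section \<open>Cells and the piecewise constant reconstruction\<close>

lemma cell_iff:
  "t \<in> cell \<omega> \<rho> M q e j \<longleftrightarrow> t \<in> pre_cell \<omega> \<rho> M q e j \<and> (\<forall>i<j. t \<notin> cell \<omega> \<rho> M q e i)"
  by (subst cell.simps) auto

lemma cell_cover:
  assumes "t \<in> M"
  shows "\<exists>j. t \<in> cell \<omega> \<rho> M q e j"
proof -
  obtain j where "t \<in> pre_cell \<omega> \<rho> M q e j"
    using tau_attained[of t] assms by (auto simp: pre_cell_def)
  \<comment> \<open>By \<open>cell_iff\<close>, \<open>t\<close> lies in cell \<open>j\<close>
    unless an earlier cell already contains it; either way some cell does.\<close>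
  then show ?thesis
    using cell_iff[of t j] by blast
qed

lemma cell_unique:
  assumes "t \<in> cell \<omega> \<rho> M q e i" "t \<in> cell \<omega> \<rho> M q e j"
  shows "i = j"
  using assms cell_iff[of t i] cell_iff[of t j] by (meson linorder_less_linear)

lemma L_method_cell: "t \<in> cell \<omega> \<rho> M q e j \<Longrightarrow> L_method \<omega> \<rho> M q e z t = z $ j"
  unfolding L_method_def using cell_unique by (metis the_equality)

text \<open>Each cell removes finitely many earlier ones, hence induction along the well-order; a
  pre-cell is the set where two measurable functions agree.\<close>

lemma cell_measurable: "cell \<omega> \<rho> M q e j \<in> sets \<nu>"
proof (induction j rule: less_induct)
  case (less j)
  have 1: "tau \<omega> \<rho> q e \<in> borel_measurable \<nu>"
    by (intro continuous_measurable H_class_continuous tau_H_class)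
  have 2: "(\<lambda>t. e $ j + \<omega> (\<rho> t (q j))) \<in> borel_measurable \<nu>"
    by (intro continuous_measurable continuous_intros modulus_metric_continuous points)
  have "pre_cell \<omega> \<rho> M q e j \<in> sets \<nu>"
    using borel_measurable_eq[OF 1 2] by (simp add: pre_cell_def space_eq)
  then show ?case
    using less by (subst cell.simps) auto
qed

lemma L_method_ess_bounded: "L_method \<omega> \<rho> M q e z \<in> ess_bounded \<nu>"
proof -
  \<comment> \<open>The cells partition \<open>M\<close>, so on \<open>M\<close> the reconstruction
    is a finite combination of their indicators.\<close>
  have eq: "L_method \<omega> \<rho> M q e z t = (\<Sum>j\<in>UNIV. z $ j * indicator (cell \<omega> \<rho> M q e j) t)"
    if "t \<in> M" for t
  proof -
    obtain j where j: "t \<in> cell \<omega> \<rho> M q e j"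
      using cell_cover \<open>t \<in> M\<close> by blast
    then have "t \<in> cell \<omega> \<rho> M q e i \<longleftrightarrow> i = j" for i
      using cell_unique by blast
    then have "(\<Sum>i\<in>UNIV. z $ i * indicator (cell \<omega> \<rho> M q e i) t) = (\<Sum>i\<in>UNIV. if i = j then z $ i else 0)"
      by (intro sum.cong) (auto simp: indicator_def)
    then show ?thesis
      using L_method_cell[OF j] by simp
  qed
  have "(\<lambda>t. \<Sum>j\<in>UNIV. z $ j * indicator (cell \<omega> \<rho> M q e j) t :: real) \<in> borel_measurable \<nu>"
    using cell_measurable by measurable
  then have "L_method \<omega> \<rho> M q e z \<in> borel_measurable \<nu>"
    using eq by (subst measurable_cong) (auto simp: space_eq)
  \<comment> \<open>This holds even outside \<open>M\<close>, since the definite description always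
    denotes some index.\<close>
  moreover have "\<bar>L_method \<omega> \<rho> M q e z t\<bar> \<le> norm z" for t
    unfolding L_method_def by (rule component_le_norm_cart)
  ultimately show ?thesis
    by (auto simp: ess_bounded_def)
qed

text \<open>On cell \<open>j\<close> the reconstruction is \<open>x (q j) + u $ j\<close>. The class
  contributes \<omega> of the distance to \<open>q j\<close>, the perturbation contributes
  \<open>e $ j\<close>, and on that cell the two add up to exactly \<tau>.\<close>

lemma L_method_error:
  assumes "x \<in> H_class \<omega> \<rho> M" "u \<in> error_box e" "t \<in> M"
  shows "\<bar>x t - L_method \<omega> \<rho> M q e (sample q x + u) t\<bar> \<le> tau \<omega> \<rho> q e t"
proof -
  obtain j where j: "t \<in> cell \<omega> \<rho> M q e j"
    using cell_cover[OF assms(3)] by blast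
  then have "tau \<omega> \<rho> q e t = e $ j + \<omega> (\<rho> t (q j))"
    using cell_iff[of t j] by (simp add: pre_cell_def)
  moreover have "\<bar>x t - x (q j)\<bar> \<le> \<omega> (\<rho> t (q j))"
    using assms points by (auto simp: H_class_def)
  moreover have "\<bar>u $ j\<bar> \<le> e $ j"
    using assms(2) by (simp add: error_box_def abs_le_iff) (metis minus_le_iff)
  ultimately show ?thesis
    unfolding L_method_cell[OF j] by (simp add: sample_def)
qed

end

section \<open>Symmetry under negation\<close>

lemma H_class_uminus: "x \<in> H_class \<omega> \<rho> M \<Longrightarrow> (\<lambda>t. - x t) \<in> H_class \<omega> \<rho> M"
  by (simp add: H_class_def abs_minus_commute)

lemma sample_uminus: "sample q (\<lambda>t. - x t) = - sample q x"
  by (simp add: sample_def vec_eq_iff)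

lemma error_box_uminus: "u \<in> error_box e \<Longrightarrow> - u \<in> error_box e"
  by (auto simp: error_box_def minus_le_iff)

section \<open>Measurability and continuity on the boundary\<close>

lemma space_surface_measure [simp]: "space (surface_measure S) = S"
  by (simp add: surface_measure_def space_restrict_space)

lemma borel_measurable_surface_measure:
  fixes f :: "'a::euclidean_space \<Rightarrow> real"
  assumes "continuous_on S f"
  shows "f \<in> borel_measurable (surface_measure S)"
proof -
  \<comment> \<open>The sigma-algebra of \<open>measure_of\<close> is determined by the generating
    sets, whatever the set function.\<close>
  have "sets (measure_of UNIV (sets borel) \<mu>) = sets (borel :: 'a measure)" for \<mu>
    using sets.sets_measure_of_eq[of "borel :: 'a measure"] by simp
  then have "sets (surface_measure S) = sets (restrict_space borel S)"
    unfolding surface_measure_def by (intro sets_restrict_space_cong)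
  then show ?thesis
    using borel_measurable_continuous_on_restrict[OF assms] measurable_cong_sets by blast
qed

text \<open>A metric is continuous for its own topology, which the second assumption identifies with
  the subspace topology.\<close>

lemma metric_continuous_on:
  assumes "Metric_space S \<rho>" "Metric_space.mtopology S \<rho> = top_of_set S" "p \<in> S"
  shows "continuous_on S (\<lambda>t. \<rho> t p)"
proof -
  interpret Metric_space S \<rho> by fact
  have "continuous_map mtopology euclideanreal (\<lambda>t. \<rho> t p)"
    using continuous_map_mdist[of mtopology Self "\<lambda>t. t" "\<lambda>_. p"] assms(3)
    by (simp add: mtopology_of_def)
  then show ?thesis
    by (simp add: assms(2))
qed

section \<open>Optimal recovery for the Dirichlet problem\<close>

theorem corollary6:
  fixes \<Omega> :: "'a::euclidean_space set"
    and G dG :: "'a \<Rightarrow> 'a \<Rightarrow> real"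
    and A\<^sub>1 A\<^sub>2 :: "('a \<Rightarrow> real) \<Rightarrow> 'a \<Rightarrow> real"
    and \<omega>\<^sub>1 \<omega>\<^sub>2 :: "real \<Rightarrow> real"
    and \<rho> :: "'a \<Rightarrow> 'a \<Rightarrow> real"
    and q\<^sub>1 :: "'m::{finite,wellorder} \<Rightarrow> 'a" and q\<^sub>2 :: "'n::{finite,wellorder} \<Rightarrow> 'a"
    and e\<^sub>1 :: "real ^ 'm::{finite,wellorder}" and e\<^sub>2 :: "real ^ 'n::{finite,wellorder}"
    and Y :: "('a \<Rightarrow> real) set" and N :: "('a \<Rightarrow> real) \<Rightarrow> real"
  assumes domain: "open \<Omega>" "connected \<Omega>" "\<Omega> \<noteq> {}" "bounded \<Omega>" "C1_boundary \<Omega>"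
    and green: "greens_function \<Omega> G"
    and normal_derivative:
      "\<And>t. t \<in> \<Omega> \<Longrightarrow>
         AE s in surface_measure (frontier \<Omega>). has_outer_normal_derivative \<Omega> (G t) s (dG t s)"
    and G_nonneg: "\<And>t s. \<lbrakk>t \<in> \<Omega>; s \<in> \<Omega>; s \<noteq> t\<rbrakk> \<Longrightarrow> G t s \<ge> 0"
    and dG_nonneg: "\<And>t. t \<in> \<Omega> \<Longrightarrow> AE s in surface_measure (frontier \<Omega>). - dG t s \<ge> 0"
    and A\<^sub>1: "\<And>f t. \<lbrakk>f \<in> ess_bounded (lebesgue_on \<Omega>); t \<in> \<Omega>\<rbrakk> \<Longrightarrow>
         has_bochner_integral (lebesgue_on \<Omega>) (\<lambda>s. G t s * f s) (A\<^sub>1 f t)"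
    and A\<^sub>2: "\<And>g t. \<lbrakk>g \<in> ess_bounded (surface_measure (frontier \<Omega>)); t \<in> \<Omega>\<rbrakk> \<Longrightarrow>
         has_bochner_integral (surface_measure (frontier \<Omega>)) (\<lambda>s. - dG t s * g s) (A\<^sub>2 g t)"
    and solution_operator:
      "\<And>f g. \<lbrakk>f \<in> ess_bounded (lebesgue_on \<Omega>); g \<in> ess_bounded (surface_measure (frontier \<Omega>))\<rbrakk> \<Longrightarrow>
         dirichlet_solution \<Omega> f g (\<lambda>t. A\<^sub>1 f t + A\<^sub>2 g t)"
    and moduli: "modulus_of_continuity \<omega>\<^sub>1" "modulus_of_continuity \<omega>\<^sub>2"
    and boundary_metric: "Metric_space (frontier \<Omega>) \<rho>"
      "Metric_space.mtopology (frontier \<Omega>) \<rho> = top_of_set (frontier \<Omega>)"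
    and points: "inj q\<^sub>1" "range q\<^sub>1 \<subseteq> \<Omega>" "inj q\<^sub>2" "range q\<^sub>2 \<subseteq> frontier \<Omega>"
    and errors: "\<And>j. e\<^sub>1 $ j \<ge> 0" "\<And>j. e\<^sub>2 $ j \<ge> 0"
    and lattice: "normed_function_lattice (lebesgue_on (\<Omega> \<union> frontier \<Omega>)) Y N"
    and bounded_in_Y: "ess_bounded (lebesgue_on (\<Omega> \<union> frontier \<Omega>)) \<subseteq> Y"
  shows
    "let A = dirichlet_operator \<Omega> A\<^sub>1 A\<^sub>2;
         W = H_class \<omega>\<^sub>1 dist \<Omega> \<times> H_class \<omega>\<^sub>2 \<rho> (frontier \<Omega>);
         I = map_prod (sample q\<^sub>1) (sample q\<^sub>2);
         U = error_box e\<^sub>1 \<times> error_box e\<^sub>2;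
         L = map_prod (L_method \<omega>\<^sub>1 dist \<Omega> q\<^sub>1 e\<^sub>1) (L_method \<omega>\<^sub>2 \<rho> (frontier \<Omega>) q\<^sub>2 e\<^sub>2);
         \<Phi> = A \<circ> L;
         \<tau> = (tau \<omega>\<^sub>1 dist q\<^sub>1 e\<^sub>1, tau \<omega>\<^sub>2 \<rho> q\<^sub>2 e\<^sub>2)
     in optimal_method Y N A W I U \<Phi> \<and>
        optimal_error Y N A W I U = recovery_error N A W I U \<Phi> \<and>
        recovery_error N A W I U \<Phi> = ennreal (N (A \<tau>))"
proof -
  let ?M = "lebesgue_on (\<Omega> \<union> frontier \<Omega>)"
  let ?\<sigma> = "surface_measure (frontier \<Omega>)"
  interpret Y: normed_function_lattice ?M Y N
    by (rule lattice)
  have \<Omega>: "\<Omega> \<in> sets lebesgue" and \<Omega>': "\<Omega> \<union> frontier \<Omega> \<in> sets lebesgue"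
    using domain(1) by auto
  interpret S1: sampled_class \<Omega> dist "lebesgue_on \<Omega>" \<omega>\<^sub>1 q\<^sub>1 e\<^sub>1
  proof (intro sampled_class.intro sampled_class_axioms.intro)
    show "Metric_space \<Omega> dist"
      by (rule Met_TC.subspace) auto
    show "space (lebesgue_on \<Omega>) = \<Omega>"
      by simp
    show "f \<in> borel_measurable (lebesgue_on \<Omega>)" if "continuous_on \<Omega> f" for f :: "'a \<Rightarrow> real"
      using that \<Omega> by (rule continuous_imp_measurable_on_sets_lebesgue)
    show "continuous_on \<Omega> (\<lambda>t. dist t p)" for p
      by (intro continuous_intros)
    show "\<exists>B. \<forall>t\<in>\<Omega>. dist t p \<le> B" for p
      using domain(4) by (metis bounded_any_center dist_commute)
  qed (use moduli points errors in auto)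
  interpret S2: sampled_class "frontier \<Omega>" \<rho> ?\<sigma> \<omega>\<^sub>2 q\<^sub>2 e\<^sub>2
  proof (intro sampled_class.intro sampled_class_axioms.intro)
    show cont: "continuous_on (frontier \<Omega>) (\<lambda>t. \<rho> t p)" if "p \<in> frontier \<Omega>" for p
      using boundary_metric that by (rule metric_continuous_on)
    \<comment> \<open>The boundary is compact, so the continuous function \<rho>(., p) attains its
      maximum.\<close>
    show "\<exists>B. \<forall>t\<in>frontier \<Omega>. \<rho> t p \<le> B" if "p \<in> frontier \<Omega>" for p
      using continuous_attains_sup[OF compact_frontier_bounded[OF domain(4)] _ cont[OF that]] that
      by blast
  qed (use boundary_metric moduli points errors in \<open>auto intro: borel_measurable_surface_measure\<close>)
  define A where "A = dirichlet_operator \<Omega> A\<^sub>1 A\<^sub>2"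
  define W where "W = H_class \<omega>\<^sub>1 dist \<Omega> \<times> H_class \<omega>\<^sub>2 \<rho> (frontier \<Omega>)"
  define I where "I = map_prod (sample q\<^sub>1) (sample q\<^sub>2)"
  define U where "U = error_box e\<^sub>1 \<times> error_box e\<^sub>2"
  define L where "L = map_prod (L_method \<omega>\<^sub>1 dist \<Omega> q\<^sub>1 e\<^sub>1) (L_method \<omega>\<^sub>2 \<rho> (frontier \<Omega>) q\<^sub>2 e\<^sub>2)"
  define \<tau> where "\<tau> = (tau \<omega>\<^sub>1 dist q\<^sub>1 e\<^sub>1, tau \<omega>\<^sub>2 \<rho> q\<^sub>2 e\<^sub>2)"
  let ?B = "ess_bounded (lebesgue_on \<Omega>) \<times> ess_bounded ?\<sigma>"
  let ?neg = "map_prod (\<lambda>f t. - f t) (\<lambda>g t. - g t) :: ('a \<Rightarrow> real) \<times> ('a \<Rightarrow> real) \<Rightarrow> _"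
  have W_B: "x \<in> ?B" if "x \<in> W" for x
    using that S1.H_class_ess_bounded S2.H_class_ess_bounded by (auto simp: W_def)
  have L_B: "L z \<in> ?B" for z
    using S1.L_method_ess_bounded S2.L_method_ess_bounded by (cases z) (auto simp: L_def)
  \<comment> \<open>Boundedness is part of \<open>dirichlet_solution\<close>; the extension by 0
    then carries it to the closed domain.\<close>
  have A_ess: "A x \<in> ess_bounded ?M" if "x \<in> ?B" for x
  proof -
    have "(\<lambda>t. A\<^sub>1 (fst x) t + A\<^sub>2 (snd x) t) \<in> ess_bounded (lebesgue_on \<Omega>)"
      using solution_operator[of "fst x" "snd x"] that
      by (auto simp: dirichlet_solution_def)
    then show ?thesis
      unfolding A_def dirichlet_operator_def
      using \<Omega> \<Omega>' by (intro ess_bounded_lebesgue_on_extend) auto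
  qed
  have A_Y: "A x \<in> Y" if "x \<in> ?B" for x
    using A_ess[OF that] bounded_in_Y by blast
  have A_neg: "A (?neg x) = (\<lambda>t. - A x t)" if "x \<in> ?B" for x
  proof
    fix t
    obtain f g where x: "x = (f, g)" by (cases x)
    with that have fg: "f \<in> ess_bounded (lebesgue_on \<Omega>)" "g \<in> ess_bounded ?\<sigma>"
      by auto
    show "A (?neg x) t = - A x t"
    proof (cases "t \<in> \<Omega>")
      case True
      have "A\<^sub>1 (\<lambda>t. - f t) t = - A\<^sub>1 f t" "A\<^sub>2 (\<lambda>t. - g t) t = - A\<^sub>2 g t"
        by (rule has_bochner_integral_mult_uminus A\<^sub>1 A\<^sub>2 fg ess_bounded_uminus True)+
      then show ?thesis
        by (simp add: A_def dirichlet_operator_def x)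
    qed (simp add: A_def dirichlet_operator_def)
  qed
  have \<tau>_W: "\<tau> \<in> W"
    using S1.tau_H_class S2.tau_H_class by (simp add: \<tau>_def W_def)
  have upper: "N (\<lambda>t. A x t - A (L (I x + u)) t) \<le> N (A \<tau>)" if "x \<in> W" "u \<in> U" for x u
  proof -
    obtain f g where x: "x = (f, g)" by (cases x)
    obtain v w where u: "u = (v, w)" by (cases u)
    let ?y = "L (I x + u)"
    \<comment> \<open>Inside the domain the interior and boundary contributions are compared
      separately and added; elsewhere all three terms are 0.\<close>
    have le: "\<bar>A x t - A ?y t\<bar> \<le> A \<tau> t" for t
    proof (cases "t \<in> \<Omega>")
      case True
      \<comment> \<open>The sign of \<open>G\<close> is known only off the diagonal, and a single
        point is null.\<close>
      have "AE s in lebesgue. s \<noteq> t"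
        using AE_not_in[of "{t}" lebesgue] by simp
      then have "AE s in lebesgue_on \<Omega>. G t s \<ge> 0"
        using G_nonneg True \<Omega> by (auto simp: AE_restrict_space_iff elim!: eventually_mono)
      then have "\<bar>A\<^sub>1 (fst x) t - A\<^sub>1 (fst ?y) t\<bar> \<le> A\<^sub>1 (fst \<tau>) t"
        using W_B[OF that(1)] L_B[of "I x + u"] W_B[OF \<tau>_W] that True
        by (intro kernel_integral_abs_diff_le[OF _ A\<^sub>1 A\<^sub>1 A\<^sub>1])
          (auto simp: x u \<tau>_def W_def U_def L_def I_def intro: S1.L_method_error)
      moreover have "\<bar>A\<^sub>2 (snd x) t - A\<^sub>2 (snd ?y) t\<bar> \<le> A\<^sub>2 (snd \<tau>) t"
        using W_B[OF that(1)] L_B[of "I x + u"] W_B[OF \<tau>_W] that True dG_nonneg[OF True]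
        by (intro kernel_integral_abs_diff_le[OF _ A\<^sub>2 A\<^sub>2 A\<^sub>2])
          (auto simp: x u \<tau>_def W_def U_def L_def I_def intro: S2.L_method_error)
      ultimately show ?thesis
        using True by (simp add: A_def dirichlet_operator_def)
    qed (simp add: A_def dirichlet_operator_def)
    have "AE t in ?M. \<bar>A x t - A ?y t\<bar> \<le> \<bar>A \<tau> t\<bar>"
      using le by (intro AE_I2) (meson abs_ge_self order_trans)
    then show ?thesis
      using W_B[OF that(1)] L_B W_B[OF \<tau>_W]
      by (intro Y.norm_mono_ess_bounded[OF bounded_in_Y] ess_bounded_diff A_ess)
  qed
  have upper': "recovery_error N A W I U (A \<circ> L) \<le> ennreal (N (A \<tau>))"
    unfolding recovery_error_def using upper by (auto intro!: SUP_least ennreal_leI)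
  have lower: "ennreal (N (A \<tau>)) \<le> recovery_error N A W I U \<Phi>" if \<Phi>: "range \<Phi> \<subseteq> Y" for \<Phi>
  proof -
    \<comment> \<open>Both signs matter: \<tau> reaches the information 0 through the perturbation
      \<open>- I \<tau>\<close>, and its negative does so through \<open>I \<tau>\<close>.\<close>
    have I\<tau>: "I \<tau> \<in> U" "- I \<tau> \<in> U"
      using S1.sample_tau S2.sample_tau by (auto simp: I_def U_def \<tau>_def error_box_uminus)
    have neg_W: "?neg \<tau> \<in> W" and neg_I: "I (?neg \<tau>) = - I \<tau>"
      using \<tau>_W by (auto simp: W_def I_def \<tau>_def H_class_uminus sample_uminus)
    \<comment> \<open>The perturbation \<open>- I x\<close> turns the information into 0, so
      \<open>\<Phi> 0\<close> is an answer the method may give for \<open>x\<close>.\<close>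
    have err: "ennreal (N (\<lambda>t. A x t - \<Phi> 0 t)) \<le> recovery_error N A W I U \<Phi>"
      if "x \<in> W" "- I x \<in> U" for x
    proof -
      have "0 \<in> (\<lambda>u. I x + u) ` U"
        using that(2) by (intro image_eqI[of _ _ "- I x"]) auto
      then show ?thesis
        unfolding recovery_error_def using that(1) by (intro SUP_upper2[of x] SUP_upper)
    qed
    \<comment> \<open>The one element \<open>\<Phi> 0\<close> must approximate both
      \<open>A \<tau>\<close> and its negative.\<close>
    have "N (A \<tau>) \<le> max (N (\<lambda>t. A \<tau> t - \<Phi> 0 t)) (N (\<lambda>t. - A \<tau> t - \<Phi> 0 t))"
      using \<Phi> by (intro Y.norm_le_max_diff A_Y W_B \<tau>_W) auto
    then have "ennreal (N (A \<tau>)) \<le> max (ennreal (N (\<lambda>t. A \<tau> t - \<Phi> 0 t))) (ennreal (N (\<lambda>t. - A \<tau> t - \<Phi> 0 t)))"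
      by (auto simp: le_max_iff_disj ennreal_leI)
    also have "\<dots> \<le> recovery_error N A W I U \<Phi>"
      using err[OF \<tau>_W] err[OF neg_W] I\<tau> by (simp add: neg_I A_neg[OF W_B[OF \<tau>_W]])
    finally show ?thesis .
  qed
  have range: "range (A \<circ> L) \<subseteq> Y"
    using A_Y[OF L_B] by (auto simp only: image_iff comp_apply)
  have err_eq: "recovery_error N A W I U (A \<circ> L) = ennreal (N (A \<tau>))"
    using upper' lower[OF range] by (rule antisym)
  \<comment> \<open>\<open>lower\<close> bounds every competing method from below, and the method
    itself attains that bound.\<close>
  have "optimal_error Y N A W I U = recovery_error N A W I U (A \<circ> L)"
    unfolding optimal_error_def
    using range lower by (intro antisym INF_greatest INF_lower) (auto simp: err_eq)
  then have "optimal_method Y N A W I U (A \<circ> L) \<and>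
      optimal_error Y N A W I U = recovery_error N A W I U (A \<circ> L) \<and>
      recovery_error N A W I U (A \<circ> L) = ennreal (N (A \<tau>))"
    using range err_eq by (simp add: optimal_method_def)
  then show ?thesis
    unfolding A_def W_def I_def U_def L_def \<tau>_def Let_def .
qed

end
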